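(* Let $n\geqslant 3$ and let $\vec{h}=(h_1,\ldots,h_n)\in\mathbb{N}^n$ with $1\leqslant h_1\leqslant\cdots\leqslant h_n$. Then for any (finite, nonempty) set of primes $\mathcal{Q}$, $$\frac{1}{\#\mathcal{Q}}\sum_{q\in\mathcal{Q}}\#\mathcal{U}_{n,q}(\vec{h})\ll h_2\log^2 h_2+\frac{h_1h_2h_3\log h_3}{\#\mathcal{Q}\,\log\log h_3},$$ where the implied constant depends only on $n$.
   Context: For a prime $q$, $\mathbb{F}_q$ is identified with $\{0,1,\ldots,q-1\}$ and $\|\zeta\|$ is the distance from a real $\zeta$ to the nearest integer. $\mathcal{U}_{n,q}(\vec{h})$ denotes the set of $u\in\mathbb{F}_q$ for which the Bohr set $\{s\in\mathbb{F}_q:\ \|u^{j} s/q\|\leqslant h_j/q,\ j=1,\ldots,n\}$ contains some $s\neq0$; equivalently, the set of $u\in\mathbb{F}_q$ for which there exist $s\in\{1,\ldots,q-1\}$ and integers $x_j$, $|x_j|\leqslant h_j$, with $s u^{j}\equiv x_j\pmod q$ for $j=1,\ldots,n$.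
   Formalization: The logarithm of h_2 is taken at max(2,h_2), and log h_3 and log log h_3 at max(3,h_3), since the bound as written fails for h_2=1 (u=0 always lies in the set) and is undefined or negative for h_3≤2; for h_2≥2 and h_3≥3 nothing changes. *)

theory Defs
  imports Complex_Main "HOL-Computational_Algebra.Primes"
begin

definition dist_nearest_int :: "real \<Rightarrow> real" where
  "dist_nearest_int x = \<bar>x - of_int (round x)\<bar>"

text \<open>
  The field with \<open>q\<close> elements is represented by \<open>{0..<q}\<close>, and \<open>h j\<close> is used for
  \<open>1 \<le> j \<le> n\<close> only. Powers and products are not reduced modulo \<open>q\<close>, because
  \<^const>\<open>dist_nearest_int\<close> has period \<open>1\<close>.
\<close>

definition bohr_set :: "nat \<Rightarrow> nat \<Rightarrow> (nat \<Rightarrow> nat) \<Rightarrow> nat \<Rightarrow> nat set" where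
  "bohr_set n q h u =
    {s \<in> {0..<q}. \<forall>j\<in>{1..n}. dist_nearest_int (real (u ^ j * s) / real q) \<le> real (h j) / real q}"

definition U_set :: "nat \<Rightarrow> nat \<Rightarrow> (nat \<Rightarrow> nat) \<Rightarrow> nat set" where
  "U_set n q h = {u \<in> {0..<q}. \<exists>s \<in> bohr_set n q h u. s \<noteq> 0}"

text \<open>
  The bound contains \<open>ln h\<^sub>2\<close>, which is \<open>0\<close> for \<open>h\<^sub>2 = 1\<close>, and \<open>ln (ln h\<^sub>3)\<close>, which is
  undefined or negative for \<open>h\<^sub>3 \<le> 2\<close>. For these values the logarithms are evaluated at \<open>2\<close>
  and \<open>3\<close> respectively, the least naturals at which they are positive. For
  \<open>h\<^sub>2 \<ge> 2\<close> and \<open>h\<^sub>3 \<ge> 3\<close> the two functions are the expressions \<open>ln h\<^sub>2\<close> and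
  \<open>ln h\<^sub>3 / ln (ln h\<^sub>3)\<close> themselves.
\<close>

definition log_pos :: "nat \<Rightarrow> real" where
  "log_pos m = ln (real (max 2 m))"

definition log_over_loglog :: "nat \<Rightarrow> real" where
  "log_over_loglog m = ln (real (max 3 m)) / ln (ln (real (max 3 m)))"

end

theory Submission
  imports Defs "HOL-Number_Theory.Cong"
begin

text \<open>
  Only the exponents \<open>1, 2, 3\<close> matter. If \<open>u \<noteq> 0\<close> lies in the set for \<open>q\<close>, with
  \<open>s u\<^sup>j \<equiv> x\<^sub>j\<close>, then the \<open>x\<^sub>j\<close> are units modulo \<open>q\<close>, \<open>u \<equiv> x\<^sub>2 / x\<^sub>1\<close>, and \<open>q\<close> divides
  \<open>D = x\<^sub>2\<^sup>2 - x\<^sub>1 x\<^sub>3\<close>. If \<open>D = 0\<close>, the reduced form \<open>b / a\<close> of \<open>x\<^sub>2 / x\<^sub>1\<close> satisfies \<open>a b dvd x\<^sub>2\<close>,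
  so \<open>\<bar>a b\<bar> \<le> h\<^sub>2\<close>, which leaves \<open>O(h\<^sub>2 log h\<^sub>2)\<close> values of \<open>u\<close>. If \<open>D \<noteq> 0\<close>, then each of the
  \<open>O(h\<^sub>1 h\<^sub>2 h\<^sub>3)\<close> triples is counted for at most \<open>\<omega>(D) = O(log h\<^sub>3 / log log h\<^sub>3)\<close> primes \<open>q\<close>.
\<close>

section \<open>Counting distinct prime divisors\<close>

lemma prod_primes_dvd:
  fixes N :: nat
  assumes "finite P" "\<And>p. p \<in> P \<Longrightarrow> prime p" "\<And>p. p \<in> P \<Longrightarrow> p dvd N"
  shows "\<Prod>P dvd N"
  using assms
proof (induction P rule: finite_induct)
  case (insert p P)
  have "coprime p (\<Prod>P)"
    using insert by (intro prod_coprime_right) (auto intro: primes_coprime)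
  with insert show ?case
    by (auto intro: divides_mult)
qed simp

text \<open>At most \<open>y\<close> of the primes lie below the threshold \<open>y\<close>; each of
  the others contributes a factor above \<open>y\<close> to a product that divides
  \<open>N\<close>.\<close>

lemma card_primes_dvd_le:
  fixes N :: nat and y :: real
  assumes "finite P" "\<And>p. p \<in> P \<Longrightarrow> prime p" "\<And>p. p \<in> P \<Longrightarrow> p dvd N"
    and "N > 0" "y > 1"
  shows "real (card P) \<le> y + ln (real N) / ln y"
proof -
  define S where "S = {p \<in> P. real p \<le> y}"
  define T where "T = {p \<in> P. real p > y}"
  have fin: "finite S" "finite T" and P: "P = S \<union> T"
    using assms(1) by (auto simp: S_def T_def)
  have "S \<subseteq> {1..nat \<lfloor>y\<rfloor>}"
    using assms(2) by (auto simp: S_def le_nat_floor Suc_le_eq prime_gt_0_nat)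
  then have "card S \<le> nat \<lfloor>y\<rfloor>"
    using card_mono[of "{1..nat \<lfloor>y\<rfloor>}" S] by simp
  then have S: "real (card S) \<le> y"
    using assms(5) by linarith
  have "y ^ card T = (\<Prod>p\<in>T. y)"
    by simp
  also have "\<dots> \<le> (\<Prod>p\<in>T. real p)"
    using assms(5) by (intro prod_mono) (auto simp: T_def)
  also have "\<dots> = real (\<Prod>T)"
    by simp
  also have "\<Prod>T \<le> N"
    using assms fin by (intro dvd_imp_le prod_primes_dvd) (auto simp: T_def)
  finally have "y ^ card T \<le> real N"
    by simp
  then have "ln (y ^ card T) \<le> ln (real N)"
    using assms by (subst ln_le_cancel_iff) auto
  then have "real (card T) * ln y \<le> ln (real N)"
    using assms by (simp add: ln_realpow)
  then have T: "real (card T) \<le> ln (real N) / ln y"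
    using assms(5) by (simp add: pos_le_divide_eq)
  have "card P \<le> card S + card T"
    unfolding P by (rule card_Un_le)
  with S T show ?thesis
    by linarith
qed

text \<open>Ensures that \<open>ln (ln H)\<close> is positive for \<open>H \<ge> 3\<close>.
  Numerically it rests on \<open>(6 / 5) ^ 6 < 3\<close>.\<close>

lemma ln_3_gt_1: "ln (3::real) > 1"
proof -
  have "ln (5 / 6 :: real) \<le> 5 / 6 - 1"
    by (rule ln_le_minus_one) simp
  then have "1 \<le> 6 * ln (6 / 5 :: real)"
    by (simp add: ln_div)
  also have "\<dots> = ln ((6 / 5) ^ 6)"
    by (simp add: ln_realpow)
  also have "\<dots> < ln 3"
    by (subst ln_less_cancel_iff) (auto simp: power_divide)
  finally show ?thesis .
qed

text \<open>With \<open>L = ln H\<close>, the threshold \<open>sqrt L\<close> balances the two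
  terms: the small primes cost at most \<open>L / ln L\<close>, the large ones at most
  \<open>6 * (L / ln L)\<close>.\<close>

lemma card_primes_dvd_le_log_over_loglog:
  fixes N m :: nat
  assumes "finite P" "\<And>p. p \<in> P \<Longrightarrow> prime p" "\<And>p. p \<in> P \<Longrightarrow> p dvd N"
    and "N > 0" "N \<le> 2 * m\<^sup>2"
  shows "real (card P) \<le> 7 * log_over_loglog m"
proof -
  define H where "H = real (max 3 m)"
  define L where "L = ln H"
  have H: "H \<ge> 3" "real m \<le> H"
    by (auto simp: H_def)
  have "ln 3 \<le> L"
    unfolding L_def using H by (subst ln_le_cancel_iff) auto
  with ln_3_gt_1 have L: "L > 1"
    by linarith
  have "real N \<le> real (2 * m\<^sup>2)"
    using assms(5) of_nat_le_iff by blast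
  also have "\<dots> = 2 * real m ^ 2"
    by simp
  \<comment> \<open>The third factor \<open>H \<ge> 3\<close> absorbs the constant 2.\<close>
  also have "\<dots> \<le> H * H ^ 2"
    using H by (intro mult_mono power_mono) auto
  also have "\<dots> = H ^ 3"
    by (simp add: power2_eq_square power3_eq_cube)
  finally have "real N \<le> H ^ 3" .
  then have "ln (real N) \<le> ln (H ^ 3)"
    using assms H by (subst ln_le_cancel_iff) auto
  then have lnN: "ln (real N) \<le> 3 * L"
    using H by (simp add: L_def ln_realpow)
  have ln_sqrt_L: "ln (sqrt L) = ln L / 2" and "ln L > 0"
    using L by (auto simp: ln_sqrt)
  have "real (card P) \<le> sqrt L + ln (real N) / ln (sqrt L)"
    using assms L by (intro card_primes_dvd_le) auto
  also have "ln (real N) / ln (sqrt L) \<le> 3 * L / (ln L / 2)"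
    unfolding ln_sqrt_L using lnN \<open>ln L > 0\<close> by (intro divide_right_mono) auto
  also have "sqrt L \<le> 1 * (L / ln L)"
  proof -
    \<comment> \<open>Passing to the fourth root \<open>t\<close> of \<open>L\<close> gives
      \<open>ln L \<le> 4 * (t - 1)\<close>, and this is at most \<open>t^2\<close> because
      \<open>(t - 2)^2 \<ge> 0\<close>.\<close>
    have "ln (sqrt (sqrt L)) \<le> sqrt (sqrt L) - 1"
      using L by (intro ln_le_minus_one) auto
    then have "ln L \<le> 4 * (sqrt (sqrt L) - 1)"
      using L by (simp add: ln_sqrt)
    also have "\<dots> \<le> sqrt L"
      using zero_le_power2[of "sqrt (sqrt L) - 2"] L by (simp add: power2_diff)
    finally have "sqrt L * ln L \<le> sqrt L * sqrt L"
      using L by (intro mult_left_mono) auto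
    then show ?thesis
      using L \<open>ln L > 0\<close> by (simp add: pos_le_divide_eq)
  qed
  finally have "real (card P) \<le> 7 * (L / ln L)"
    by (simp add: field_simps)
  then show ?thesis
    by (simp add: log_over_loglog_def L_def H_def)
qed

section \<open>Harmonic sums and lattice points under a hyperbola\<close>

lemma sum_inverse_le_ln:
  assumes "m \<ge> 1"
  shows "(\<Sum>a=1..m. 1 / real a) \<le> 1 + ln (real m)"
  using assms
proof (induction m rule: dec_induct)
  case (step m)
  have "ln (real m / real (Suc m)) \<le> real m / real (Suc m) - 1"
    using step by (intro ln_le_minus_one) auto
  then have "ln (real m) - ln (real (Suc m)) \<le> - (1 / real (Suc m))"
    using step by (simp add: ln_div field_simps)
  with step show ?case
    by simp
qed simp

text \<open>The fractions \<open>b / a\<close> with \<open>a \<ge> 1\<close> and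
  \<open>a * \<bar>b\<bar> \<le> m\<close>, sliced by the denominator so that their number is a
  harmonic sum.\<close>

definition hyperbolic_pairs :: "nat \<Rightarrow> (nat \<times> int) set" where
  "hyperbolic_pairs m = (SIGMA a:{1..m}. {- int (m div a)..int (m div a)})"

lemma finite_hyperbolic_pairs [simp]: "finite (hyperbolic_pairs m)"
  by (simp add: hyperbolic_pairs_def)

lemma mem_hyperbolic_pairs:
  assumes "a \<ge> 1" "a \<le> m" "int a * \<bar>b\<bar> \<le> int m"
  shows "(a, b) \<in> hyperbolic_pairs m"
proof -
  have "nat \<bar>b\<bar> * a \<le> m"
    using assms(3) by (simp add: mult.commute flip: of_nat_le_iff[where 'a = int])
  then have "nat \<bar>b\<bar> \<le> m div a"
    using assms by (simp add: less_eq_div_iff_mult_less_eq)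
  then show ?thesis
    using assms by (auto simp: hyperbolic_pairs_def)
qed

lemma card_hyperbolic_pairs_le:
  assumes "m \<ge> 1"
  shows "real (card (hyperbolic_pairs m)) \<le> 16 * (real m * (log_pos m)\<^sup>2)"
proof -
  define l where "l = log_pos m"
  have "ln 2 \<le> l"
    unfolding l_def log_pos_def by (subst ln_le_cancel_iff) auto
  \<comment> \<open>Gives \<open>ln 2 \<ge> 1 / 2\<close>, a lower bound for \<open>l\<close> that
    covers \<open>m = 1\<close> as well, since \<open>log_pos\<close> is never evaluated below
    2.\<close>
  moreover have "ln (1 / 2 :: real) \<le> 1 / 2 - 1"
    by (rule ln_le_minus_one) simp
  ultimately have l: "1 / 2 \<le> l"
    by (simp add: ln_div)
  have "ln (real m) \<le> l"
    unfolding l_def log_pos_def using assms by (subst ln_le_cancel_iff) auto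
  then have sum: "(\<Sum>a=1..m. 1 / real a) \<le> 1 + l"
    using sum_inverse_le_ln[OF assms] by linarith
  have "real (card (hyperbolic_pairs m)) = (\<Sum>a=1..m. real (2 * (m div a) + 1))"
    unfolding hyperbolic_pairs_def by (simp add: card_SigmaI nat_add_distrib)
  also have "\<dots> \<le> (\<Sum>a=1..m. 2 * real m * (1 / real a) + 1)"
  proof (rule sum_mono)
    fix a
    show "real (2 * (m div a) + 1) \<le> 2 * real m * (1 / real a) + 1"
      using of_nat_div_le_of_nat[of m a, where ?'a = real] by simp
  qed
  also have "\<dots> = 2 * real m * (\<Sum>a=1..m. 1 / real a) + real m"
    by (simp add: sum.distrib sum_distrib_left)
  also have "\<dots> \<le> 2 * real m * (1 + l) + real m"
    using sum by (intro add_right_mono mult_left_mono) auto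
  also have "\<dots> = real m * (3 + 2 * l)"
    by (simp add: algebra_simps)
  also have "\<dots> \<le> real m * (16 * l\<^sup>2)"
  proof (intro mult_left_mono)
    \<comment> \<open>The product is \<open>16 * l^2 - 2 * l - 3\<close>; the constant 16 makes it
      vanish at the extreme value \<open>l = 1 / 2\<close>.\<close>
    have "0 \<le> (2 * l - 1) * (8 * l + 3)"
      using l by (intro mult_nonneg_nonneg) auto
    then show "3 + 2 * l \<le> 16 * l\<^sup>2"
      by (simp add: power2_eq_square algebra_simps)
  qed simp
  finally show ?thesis
    by (simp add: l_def algebra_simps)
qed

section \<open>From Bohr sets to congruences and reduced fractions\<close>

lemma bohr_setE:
  assumes "s \<in> bohr_set n q h u" "j \<in> {1..n}" "q > 0"
  obtains x where "\<bar>x\<bar> \<le> int (h j)" "[int s * int u ^ j = x] (mod int q)"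
proof -
  \<comment> \<open>Multiplied by \<open>q\<close>, the distance to the nearest integer becomes
    \<open>\<bar>x\<bar>\<close> for an integer \<open>x\<close> congruent to
    \<open>u ^ j * s\<close>.\<close>
  define r where "r = round (real (u ^ j * s) / real q)"
  define x where "x = int (u ^ j * s) - int q * r"
  have "\<bar>real (u ^ j * s) / real q - of_int r\<bar> \<le> real (h j) / real q"
    using assms by (auto simp: bohr_set_def dist_nearest_int_def r_def)
  then have "\<bar>real (u ^ j * s) / real q - of_int r\<bar> * real q \<le> real (h j)"
    using assms(3) by (simp add: pos_le_divide_eq)
  also have "\<bar>real (u ^ j * s) / real q - of_int r\<bar> * real q
      = \<bar>(real (u ^ j * s) / real q - of_int r) * real q\<bar>"
    by (simp add: abs_mult)
  also have "(real (u ^ j * s) / real q - of_int r) * real q = of_int x"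
    using assms(3) by (simp add: x_def field_simps)
  finally have "\<bar>x\<bar> \<le> int (h j)"
    by linarith
  moreover have "[int s * int u ^ j = x] (mod int q)"
    by (simp add: x_def cong_iff_dvd_diff mult.commute)
  ultimately show ?thesis
    by (rule that)
qed

text \<open>With \<open>b / a\<close> the reduced form of \<open>y / x\<close>, the equation becomes
  \<open>g * b^2 = a * z\<close>. As \<open>a\<close> is coprime to \<open>b\<close>, it divides
  \<open>g\<close>, hence \<open>a * b\<close> divides \<open>g * b = y\<close>.\<close>

lemma square_eq_mult_reduced:
  fixes x y z :: int
  assumes "x \<noteq> 0" "y\<^sup>2 = x * z"
  obtains g a b where "a > 0" "x = g * a" "y = g * b" "a * b dvd y"
proof -
  define g0 where "g0 = gcd x y"
  have "g0 \<noteq> 0"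
    using assms by (simp add: g0_def)
  \<comment> \<open>The sign of \<open>x\<close> is moved into \<open>g\<close>, so that the
    denominator \<open>a\<close> is positive.\<close>
  define e where "e = sgn x"
  define g where "g = e * g0"
  define a where "a = x div g"
  define b where "b = y div g"
  have e: "e = 1 \<or> e = -1" "e * x > 0"
    using assms by (auto simp: e_def sgn_if)
  have "g \<noteq> 0"
    using e \<open>g0 \<noteq> 0\<close> by (auto simp: g_def)
  have "g dvd x" "g dvd y"
    using e by (auto simp: g_def g0_def)
  then have xy: "x = g * a" "y = g * b"
    by (auto simp: a_def b_def)
  have "g0 > 0"
    using \<open>g0 \<noteq> 0\<close> by (simp add: g0_def)
  moreover have "g0 * a > 0"
    using e xy(1) by (auto simp: g_def)
  ultimately have "a > 0"
    by (simp add: zero_less_mult_iff)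
  have "coprime a b"
  proof -
    have "coprime (x div g0) (y div g0)"
      unfolding g0_def using assms by (intro div_gcd_coprime) auto
    moreover have "x div g0 = e * a" "y div g0 = e * b"
      using xy \<open>g0 \<noteq> 0\<close> by (auto simp: g_def)
    ultimately show ?thesis
      using e by auto
  qed
  have "g * b\<^sup>2 = a * z"
    using assms(2) xy \<open>g \<noteq> 0\<close> by (auto simp: power2_eq_square algebra_simps)
  then have "a dvd g * b\<^sup>2"
    by simp
  then have "a dvd g"
    using \<open>coprime a b\<close> by (simp add: coprime_dvd_mult_left_iff)
  then have "a * b dvd y"
    using xy by simp
  with \<open>a > 0\<close> xy show ?thesis
    by (rule that)
qed

section \<open>Residues as ratios, and the box of triples\<close>

definition residue_of_ratio :: "nat \<Rightarrow> nat \<Rightarrow> int \<Rightarrow> int \<Rightarrow> bool" where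
  "residue_of_ratio q u a b \<longleftrightarrow> \<not> int q dvd a \<and> [int u * a = b] (mod int q)"

text \<open>The denominator \<open>a\<close> is a unit modulo the prime \<open>q\<close> and
  cancels. Counting residues is thereby reduced to counting pairs \<open>(a, b)\<close>.\<close>

lemma residue_of_ratio_unique:
  assumes "prime q" "u < q" "v < q" "residue_of_ratio q u a b" "residue_of_ratio q v a b"
  shows "u = v"
proof -
  have "[int u * a = int v * a] (mod int q)"
    using assms by (auto simp: residue_of_ratio_def intro: cong_trans cong_sym)
  then have "int q dvd (int u - int v) * a"
    by (simp add: cong_iff_dvd_diff algebra_simps)
  then have "int q dvd int u - int v"
    using assms by (auto simp: residue_of_ratio_def prime_dvd_mult_iff)
  then have "[int u = int v] (mod int q)"
    by (simp add: cong_iff_dvd_diff)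
  then show ?thesis
    using assms by (simp add: cong_int_iff cong_less_modulus_unique_nat)
qed

text \<open>Triples with \<open>y\<^sup>2 = x * z\<close> are left out, because every prime divides
  0; the others have a nonzero determinant with few prime divisors.\<close>

definition triple_box :: "(nat \<Rightarrow> nat) \<Rightarrow> (int \<times> int \<times> int) set" where
  "triple_box h =
    {(x, y, z). \<bar>x\<bar> \<le> int (h 1) \<and> \<bar>y\<bar> \<le> int (h 2) \<and> \<bar>z\<bar> \<le> int (h 3) \<and> y\<^sup>2 \<noteq> x * z}"

lemma triple_box_subset:
  "triple_box h \<subseteq> {- int (h 1)..int (h 1)} \<times> {- int (h 2)..int (h 2)} \<times> {- int (h 3)..int (h 3)}"
  by (auto simp: triple_box_def)

lemma finite_triple_box [simp]: "finite (triple_box h)"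
  by (rule finite_subset[OF triple_box_subset]) simp

lemma card_triple_box_le:
  assumes "1 \<le> h 1" "1 \<le> h 2" "1 \<le> h 3"
  shows "card (triple_box h) \<le> 27 * (h 1 * h 2 * h 3)"
proof -
  have "card (triple_box h) \<le> (2 * h 1 + 1) * ((2 * h 2 + 1) * (2 * h 3 + 1))"
    using card_mono[OF _ triple_box_subset[of h]]
    by (simp add: card_cartesian_product nat_add_distrib nat_mult_distrib)
  also have "\<dots> \<le> (3 * h 1) * ((3 * h 2) * (3 * h 3))"
    using assms by (intro mult_le_mono) auto
  finally show ?thesis
    by (simp add: algebra_simps)
qed

section \<open>The bound for a single prime\<close>

lemma U_set_cases:
  assumes "n \<ge> 3" "prime q" "1 \<le> h 2" "u \<in> U_set n q h"
  obtains (degenerate) a b where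
      "(a, b) \<in> hyperbolic_pairs (h 2)" "residue_of_ratio q u (int a) b"
    | (generic) x y z where
      "(x, y, z) \<in> triple_box h" "int q dvd y\<^sup>2 - x * z" "residue_of_ratio q u x y"
proof (cases "u = 0")
  case True
  \<comment> \<open>The residue 0 is not a unit, so it is treated apart, as the fraction 0 /
    1.\<close>
  have "(1, 0) \<in> hyperbolic_pairs (h 2)"
    using assms by (intro mem_hyperbolic_pairs) auto
  moreover have "residue_of_ratio q u (int 1) 0"
    using True assms prime_gt_1_nat[of q] by (simp add: residue_of_ratio_def)
  ultimately show ?thesis
    by (rule degenerate)
next
  case False
  have pq: "prime (int q)" "q > 0"
    using assms by (auto simp: prime_gt_0_nat)
  obtain s where s: "s \<in> bohr_set n q h u" "s \<noteq> 0" and "u < q"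
    using assms by (auto simp: U_set_def)
  obtain x where x: "\<bar>x\<bar> \<le> int (h 1)" "[int s * int u ^ 1 = x] (mod int q)"
    by (rule bohr_setE[OF s(1), of 1]) (use assms pq in auto)
  obtain y where y: "\<bar>y\<bar> \<le> int (h 2)" "[int s * int u ^ 2 = y] (mod int q)"
    by (rule bohr_setE[OF s(1), of 2]) (use assms pq in auto)
  obtain z where z: "\<bar>z\<bar> \<le> int (h 3)" "[int s * int u ^ 3 = z] (mod int q)"
    by (rule bohr_setE[OF s(1), of 3]) (use assms pq in auto)
  have "s < q"
    using s by (simp add: bohr_set_def)
  \<comment> \<open>Both \<open>s\<close> and \<open>u\<close> are positive and below
    \<open>q\<close>, hence units, and so are all \<open>s * u ^ j\<close>.\<close>
  then have su: "\<not> int q dvd int s" "\<not> int q dvd int u"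
    using s False \<open>u < q\<close> by (auto dest: dvd_imp_le)
  have "\<not> int q dvd int s * int u ^ j" for j
    using su pq(1) prime_dvd_mult_iff[OF pq(1)] prime_dvd_power[OF pq(1)] by blast
  then have x0: "\<not> int q dvd x" and y0: "\<not> int q dvd y"
    using cong_trans[OF x(2)] cong_trans[OF y(2)] unfolding cong_0_iff[symmetric] by blast+
  have "[int u * x = int u * (int s * int u ^ 1)] (mod int q)"
    by (rule cong_scalar_left[OF cong_sym[OF x(2)]])
  also have "int u * (int s * int u ^ 1) = int s * int u ^ 2"
    by (simp add: power2_eq_square)
  finally have ratio: "residue_of_ratio q u x y"
    using x0 y(2) cong_trans by (auto simp: residue_of_ratio_def)
  have D: "int q dvd y\<^sup>2 - x * z"
  proof -
    have "[y\<^sup>2 = (int s * int u ^ 2)\<^sup>2] (mod int q)"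
      by (rule cong_pow[OF cong_sym[OF y(2)]])
    \<comment> \<open>The exponents 1, 2, 3 form an arithmetic progression, so
      \<open>s * u ^ j\<close> is in geometric progression.\<close>
    also have "(int s * int u ^ 2)\<^sup>2 = (int s * int u ^ 1) * (int s * int u ^ 3)"
      by (simp add: power2_eq_square power3_eq_cube)
    also have "[\<dots> = x * z] (mod int q)"
      by (rule cong_mult[OF x(2) z(2)])
    finally show ?thesis
      by (simp add: cong_iff_dvd_diff)
  qed
  show ?thesis
  proof (cases "y\<^sup>2 = x * z")
    case False
    then have "(x, y, z) \<in> triple_box h"
      using x y z by (simp add: triple_box_def)
    then show ?thesis
      using D ratio by (rule generic)
  next
    case True
    have "x \<noteq> 0" "y \<noteq> 0"
      using x0 y0 by auto
    obtain g a b where gab: "a > 0" "x = g * a" "y = g * b" "a * b dvd y"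
      using square_eq_mult_reduced[OF \<open>x \<noteq> 0\<close> True] .
    have "\<bar>a * b\<bar> \<le> \<bar>y\<bar>"
      using gab(4) \<open>y \<noteq> 0\<close> by (intro dvd_imp_le_int)
    then have ab: "a * \<bar>b\<bar> \<le> int (h 2)"
      using y(1) gab(1) by (simp add: abs_mult)
    \<comment> \<open>A nonzero \<open>b\<close> turns the bound on \<open>a * \<bar>b\<bar>\<close>
      into the bound \<open>a \<le> h 2\<close> on the denominator alone.\<close>
    have "b \<noteq> 0"
      using gab \<open>y \<noteq> 0\<close> by auto
    then have "a * 1 \<le> a * \<bar>b\<bar>"
      using gab(1) by (intro mult_left_mono) auto
    with ab have "a \<le> int (h 2)"
      by linarith
    with ab gab(1) have "(nat a, b) \<in> hyperbolic_pairs (h 2)"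
      by (intro mem_hyperbolic_pairs) auto
    moreover have "residue_of_ratio q u (int (nat a)) b"
    proof -
      \<comment> \<open>Since \<open>x = g * a\<close> is a unit modulo \<open>q\<close>, so is
        \<open>g\<close>, and the ratio survives reduction to lowest terms.\<close>
      have "int q dvd g * (int u * a - b)"
        using ratio gab(2,3) by (simp add: residue_of_ratio_def cong_iff_dvd_diff algebra_simps)
      moreover have "\<not> int q dvd g" "\<not> int q dvd a"
        using x0 gab(2) by auto
      ultimately show ?thesis
        using pq gab(1) by (auto simp: residue_of_ratio_def cong_iff_dvd_diff prime_dvd_mult_iff)
    qed
    ultimately show ?thesis
      by (rule degenerate)
  qed
qed

text \<open>Every \<open>u\<close> has a witnessing pair or triple, and by uniqueness a witness
  serves only one \<open>u < q\<close>. Hence there are no more residues than witnesses.\<close>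

lemma card_U_set_le:
  assumes "n \<ge> 3" "prime q" "1 \<le> h 2"
  shows "card (U_set n q h) \<le> card (hyperbolic_pairs (h 2))
    + card {(x, y, z) \<in> triple_box h. int q dvd y\<^sup>2 - x * z}"
proof -
  define T where "T = {(x, y, z) \<in> triple_box h. int q dvd y\<^sup>2 - x * z}"
  have "finite T"
    by (rule finite_subset[OF _ finite_triple_box[of h]]) (auto simp: T_def)
  define A where "A = {u. u < q \<and> (\<exists>(a, b) \<in> hyperbolic_pairs (h 2). residue_of_ratio q u (int a) b)}"
  define B where "B = {u. u < q \<and> (\<exists>(x, y, z) \<in> T. residue_of_ratio q u x y)}"
  have "U_set n q h \<subseteq> A \<union> B"
  proof
    fix u
    assume u: "u \<in> U_set n q h"
    then have "u < q"
      by (simp add: U_set_def)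
    from assms u show "u \<in> A \<union> B"
      by (cases rule: U_set_cases) (use \<open>u < q\<close> in \<open>auto simp: A_def B_def T_def\<close>)
  qed
  moreover have "finite (A \<union> B)"
    by (auto simp: A_def B_def)
  ultimately have "card (U_set n q h) \<le> card (A \<union> B)"
    by (intro card_mono)
  also have "\<dots> \<le> card A + card B"
    by (rule card_Un_le)
  also have "card A \<le> card (hyperbolic_pairs (h 2))"
    by (rule card_le_if_inj_on_rel[where r = "\<lambda>u (a, b). u < q \<and> residue_of_ratio q u (int a) b"])
      (use assms in \<open>auto simp: A_def intro: residue_of_ratio_unique\<close>)
  also have "card B \<le> card T"
    by (rule card_le_if_inj_on_rel[where r = "\<lambda>u (x, y, z). u < q \<and> residue_of_ratio q u x y"])
      (use assms \<open>finite T\<close> in \<open>auto simp: B_def intro: residue_of_ratio_unique\<close>)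
  finally show ?thesis
    by (simp add: T_def)
qed

section \<open>Summation over the primes\<close>

lemma card_primes_dvd_triple_le:
  assumes "(x, y, z) \<in> triple_box h" "h 1 \<le> h 3" "h 2 \<le> h 3"
    and "finite Q" "\<forall>q\<in>Q. prime q"
  shows "real (card {q \<in> Q. int q dvd y\<^sup>2 - x * z}) \<le> 7 * log_over_loglog (h 3)"
proof (rule card_primes_dvd_le_log_over_loglog)
  let ?D = "y\<^sup>2 - x * z"
  have b: "\<bar>x\<bar> \<le> int (h 3)" "\<bar>y\<bar> \<le> int (h 3)" "\<bar>z\<bar> \<le> int (h 3)"
    using assms by (auto simp: triple_box_def)
  \<comment> \<open>All three coordinates are bounded by the largest height \<open>h 3\<close>,
    which gives the form \<open>2 * m^2\<close> with \<open>m = h 3\<close>.\<close>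
  have "\<bar>?D\<bar> \<le> \<bar>y\<bar> * \<bar>y\<bar> + \<bar>x\<bar> * \<bar>z\<bar>"
    using abs_triangle_ineq4[of "y\<^sup>2" "x * z"] by (simp add: abs_mult power2_eq_square)
  also have "\<dots> \<le> int (h 3) * int (h 3) + int (h 3) * int (h 3)"
    using b by (intro add_mono mult_mono) auto
  finally show "nat \<bar>?D\<bar> \<le> 2 * (h 3)\<^sup>2"
    by (simp add: power2_eq_square nat_le_iff)
  show "nat \<bar>?D\<bar> > 0"
    using assms by (auto simp: triple_box_def)
  show "q dvd nat \<bar>?D\<bar>" if "q \<in> {q \<in> Q. int q dvd ?D}" for q
    using that by (simp add: nat_abs_dvd_iff dvd_nat_abs_iff)
qed (use assms in auto)

theorem theorem2p4:
  fixes n :: nat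
  assumes "n \<ge> 3"
  shows "\<exists>C::real. C > 0 \<and>
    (\<forall>(h :: nat \<Rightarrow> nat) (Q :: nat set).
      1 \<le> h 1 \<longrightarrow> (\<forall>i\<in>{1..<n}. h i \<le> h (i + 1)) \<longrightarrow>
      finite Q \<longrightarrow> Q \<noteq> {} \<longrightarrow> (\<forall>q\<in>Q. prime q) \<longrightarrow>
      (1 / real (card Q)) * (\<Sum>q\<in>Q. real (card (U_set n q h)))
        \<le> C * (real (h 2) * (log_pos (h 2))\<^sup>2
             + real (h 1 * h 2 * h 3) * log_over_loglog (h 3) / real (card Q)))"
\<comment> \<open>The constant is \<open>27 * 7\<close>: 27 from the size of the box, 7 from the
  prime divisor bound. It exceeds the 16 of the degenerate part.\<close>
proof (intro exI[of _ 189] conjI allI impI)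
  fix h :: "nat \<Rightarrow> nat" and Q :: "nat set"
  assume h1: "1 \<le> h 1" and mono: "\<forall>i\<in>{1..<n}. h i \<le> h (i + 1)"
    and Q: "finite Q" "Q \<noteq> {}" "\<forall>q\<in>Q. prime q"
  have h12: "h 1 \<le> h 2" and h23: "h 2 \<le> h 3"
    using bspec[OF mono, of 1] bspec[OF mono, of 2] assms
    by (simp_all add: numeral_2_eq_2 numeral_3_eq_3)
  have h2: "1 \<le> h 2" and h3: "1 \<le> h 3"
    using h1 h12 h23 by linarith+
  define k where "k = real (card Q)"
  have k: "k > 0"
    using Q by (simp add: k_def card_gt_0_iff)
  define E where "E = real (h 2) * (log_pos (h 2))\<^sup>2"
  define F where "F = real (h 1 * h 2 * h 3) * log_over_loglog (h 3)"
  define r where "r = (\<lambda>q (x, y, z). int q dvd y\<^sup>2 - x * z)"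
  have "0 \<le> E"
    by (simp add: E_def)
  \<comment> \<open>Nonnegativity is read off from the prime divisor bound for the empty set of
    primes.\<close>
  have "(0::real) \<le> 7 * log_over_loglog (h 3)"
    using card_primes_dvd_le_log_over_loglog[of "{}" 1 "h 3"] h3 by simp
  have "(\<Sum>q\<in>Q. real (card {t \<in> triple_box h. r q t})) = real (\<Sum>q\<in>Q. card {t \<in> triple_box h. r q t})"
    by simp
  \<comment> \<open>Double counting: each triple is weighted by the number of primes of
    \<open>Q\<close> that divide its determinant.\<close>
  also have "(\<Sum>q\<in>Q. card {t \<in> triple_box h. r q t}) = (\<Sum>t\<in>triple_box h. card {q \<in> Q. r q t})"
    using Q by (intro sum_multicount_gen) auto
  also have "real \<dots> = (\<Sum>t\<in>triple_box h. real (card {q \<in> Q. r q t}))"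
    by simp
  also have "\<dots> \<le> (\<Sum>t\<in>triple_box h. 7 * log_over_loglog (h 3))"
  proof (rule sum_mono)
    fix t
    assume "t \<in> triple_box h"
    then show "real (card {q \<in> Q. r q t}) \<le> 7 * log_over_loglog (h 3)"
      using card_primes_dvd_triple_le[of _ _ _ h Q] h12 h23 Q by (cases t) (auto simp: r_def)
  qed
  also have "\<dots> = real (card (triple_box h)) * (7 * log_over_loglog (h 3))"
    by simp
  also have "\<dots> \<le> real (27 * (h 1 * h 2 * h 3)) * (7 * log_over_loglog (h 3))"
    using card_triple_box_le[OF h1 h2 h3] \<open>0 \<le> 7 * log_over_loglog (h 3)\<close>
    by (intro mult_right_mono) (simp_all only: of_nat_le_iff)
  also have "\<dots> = 189 * F"
    by (simp add: F_def)
  finally have gen: "(\<Sum>q\<in>Q. real (card {t \<in> triple_box h. r q t})) \<le> 189 * F" .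
  have "(\<Sum>q\<in>Q. real (card (U_set n q h)))
      \<le> (\<Sum>q\<in>Q. 16 * E + real (card {t \<in> triple_box h. r q t}))"
  proof (rule sum_mono)
    fix q
    assume "q \<in> Q"
    then have "card (U_set n q h) \<le> card (hyperbolic_pairs (h 2)) + card {t \<in> triple_box h. r q t}"
      using card_U_set_le[of n q h] assms Q h2 by (simp add: r_def case_prod_unfold)
    then show "real (card (U_set n q h)) \<le> 16 * E + real (card {t \<in> triple_box h. r q t})"
      using card_hyperbolic_pairs_le[OF h2] by (simp add: E_def)
  qed
  \<comment> \<open>The degenerate bound recurs for each of the \<open>k\<close> primes and survives
    averaging; the triples are bounded for all primes at once, so their share is divided by
    \<open>k\<close>.\<close>
  also have "\<dots> \<le> k * (16 * E) + 189 * F"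
    using gen by (simp add: sum.distrib k_def)
  finally have "(1 / k) * (\<Sum>q\<in>Q. real (card (U_set n q h))) \<le> (1 / k) * (k * (16 * E) + 189 * F)"
    using k by (intro mult_left_mono) auto
  also have "\<dots> = 16 * E + 189 * (F / k)"
    using k by (simp add: field_simps)
  also have "\<dots> \<le> 189 * (E + F / k)"
    using \<open>0 \<le> E\<close> by simp
  finally show "(1 / real (card Q)) * (\<Sum>q\<in>Q. real (card (U_set n q h)))
      \<le> 189 * (real (h 2) * (log_pos (h 2))\<^sup>2
        + real (h 1 * h 2 * h 3) * log_over_loglog (h 3) / real (card Q))"
    by (simp add: E_def F_def k_def)
qed simp

end
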